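(* Assume the Generalized Continuum Hypothesis (GCH). Let $X$ be a real Banach space and let $\Gamma$ be an infinite regular cardinal. Suppose that $F\in\mathcal C^{1,+}(B_{\ell_\infty(\Gamma)};X)$ satisfies $\inf_{\gamma<\Gamma}\|F(e_\gamma)-F(0)\|>0$. Then there exist $x\in B_{\ell_\infty(\Gamma)}$ and $\Gamma'\subset\Gamma$ of the same cardinality as $\Gamma$ such that $dF(x)\upharpoonright_{\ell_\infty(\Gamma')}$ is an isomorphism (onto its image). In particular, $X$ contains a linear subspace isomorphic to $\ell_\infty(\Gamma)$.
   Context: All Banach spaces are real; $B_Z$ is the closed unit ball of a Banach space $Z$. A cardinal $\Gamma$ is identified with the least ordinal of that cardinality, and is used as an index set; $\ell_\infty(\Gamma)$ is the space of bounded real functions on $\Gamma$ with the supremum norm, and $e_\gamma=\chi_{\{\gamma\}}$, $\gamma<\Gamma$, are the standard unit vectors. For $\Gamma'\subset\Gamma$, $\ell_\infty(\Gamma')$ is identified with the subspace of $\ell_\infty(\Gamma)$ of elements vanishing outside $\Gamma'$. For a convex set $V\subset Z$ with non-empty interior and a Banach space $Y$, $\mathcal C^{1,+}(V;Y)$ is the space of continuous mappings $f:V\to Y$ that are Fréchet differentiable on $\operatorname{Int}V$ and whose derivative $df:\operatorname{Int}V\to\mathcal L(Z;Y)$ (operator norm) is uniformly continuous. At points $x$ of the boundary of the closed ball, $df(x)$ denotes the value of the unique continuous extension of $df$ from the interior. A bounded linear operator $T$ on a normed space $E$ is called an isomorphism (onto its image) if there is $c>0$ with $\|Ty\|\ge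 c\|y\|$ for all $y\in E$. *)

theory Defs
  imports "HOL-Probability.Discrete_Topology"
begin

unbundle cardinal_syntax

text \<open>The cardinal \<open>\<Gamma>\<close> is represented by an arbitrary type \<open>'g\<close>, i.e. by the index set
  \<open>UNIV :: 'g set\<close>. Every function on a discrete space is continuous, so the bounded continuous
  functions on \<^typ>\<open>'g discrete\<close> with the supremum norm are all bounded functions on \<open>'g\<close>.\<close>

type_synonym 'g linf = "'g discrete \<Rightarrow>\<^sub>C real"

definition unit_vec :: "'g \<Rightarrow> 'g linf" where
  "unit_vec \<gamma> = Bcontfun (\<lambda>d. if of_discrete d = \<gamma> then 1 else 0)"

definition linf_on :: "'g set \<Rightarrow> 'g linf set" where
  "linf_on G = {y. \<forall>\<gamma>. \<gamma> \<notin> G \<longrightarrow> apply_bcontfun y (discrete \<gamma>) = 0}"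

lemma all_bounded_in_bcontfun:
  fixes f :: "'g discrete \<Rightarrow> real"
  shows "f \<in> bcontfun \<longleftrightarrow> bounded (range f)"
  by (auto simp: bcontfun_def continuous_on_open_vimage open_discrete)

lemma unit_vec_apply: "apply_bcontfun (unit_vec \<gamma>) (discrete \<delta>) = (if \<delta> = \<gamma> then 1 else 0)"
proof -
  have "bounded (range (\<lambda>d. if of_discrete d = \<gamma> then 1 else (0::real)))"
    by (rule boundedI[where B = 1]) auto
  then show ?thesis
    by (simp add: unit_vec_def Bcontfun_inverse all_bounded_in_bcontfun discrete_inverse)
qed

text \<open>A formula cannot quantify over all types, so GCH is stated for the cardinals living on a
  given type: \<open>2\<^sup>\<kappa> = \<kappa>\<^sup>+\<close> for every infinite cardinal \<open>\<kappa>\<close> not exceeding the cardinality of \<open>'u\<close>.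
  Each instance is a consequence of the full GCH; the relevant instances are those for the index
  type and for the spaces involved.\<close>

definition GCH :: "'u itself \<Rightarrow> bool" where
  "GCH (U :: 'u itself) \<longleftrightarrow>
     (\<forall>r :: 'u rel. Card_order r \<and> cinfinite r \<longrightarrow> |Pow (Field r)| =o cardSuc r)"

definition frechet :: "('a::real_normed_vector \<Rightarrow> 'b::real_normed_vector) \<Rightarrow> 'a \<Rightarrow> 'a \<Rightarrow>\<^sub>L 'b" where
  "frechet f x = Blinfun (frechet_derivative f (at x))"

text \<open>The set \<open>V\<close> is meant to be convex with non-empty interior. Only the values of \<open>f\<close> on \<open>V\<close>
  matter.\<close>

definition C1plus :: "'a::real_normed_vector set \<Rightarrow> ('a \<Rightarrow> 'b::real_normed_vector) set" where
  "C1plus V = {f. continuous_on V f \<and> (\<forall>x\<in>interior V. f differentiable (at x)) \<and>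
                  uniformly_continuous_on (interior V) (frechet f)}"

definition deriv_on ::
    "'a::real_normed_vector set \<Rightarrow> ('a \<Rightarrow> 'b::real_normed_vector) \<Rightarrow> 'a \<Rightarrow> 'a \<Rightarrow>\<^sub>L 'b" where
  "deriv_on V f x =
     (if x \<in> interior V then frechet f x else Lim (at x within interior V) (frechet f))"

lemma frechet_has_derivative:
  assumes "f differentiable (at x)"
  shows "(f has_derivative blinfun_apply (frechet f x)) (at x)"
proof -
  have d: "(f has_derivative frechet_derivative f (at x)) (at x)"
    using assms frechet_derivative_works by blast
  then have "bounded_linear (frechet_derivative f (at x))"
    by (rule has_derivative_bounded_linear)
  with d show ?thesis
    by (simp add: frechet_def bounded_linear_Blinfun_apply)
qed

lemma deriv_on_unique_extension:
  fixes f :: "'a::real_normed_vector \<Rightarrow> 'b::banach"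
  assumes f: "f \<in> C1plus V" and V: "V \<subseteq> closure (interior V)"
  shows "continuous_on V (deriv_on V f)"
    and "\<And>h x. continuous_on V h \<Longrightarrow> (\<And>z. z \<in> interior V \<Longrightarrow> h z = frechet f z) \<Longrightarrow>
           x \<in> V \<Longrightarrow> h x = deriv_on V f x"
proof -
  let ?I = "interior V"
  have uc: "uniformly_continuous_on ?I (frechet f)"
    using f by (simp add: C1plus_def)
  have ext: "h x = deriv_on V f x"
    if h: "continuous_on V h" "\<And>z. z \<in> ?I \<Longrightarrow> h z = frechet f z" and x: "x \<in> V" for h x
  proof (cases "x \<in> ?I")
    case True
    then show ?thesis by (simp add: deriv_on_def h)
  next
    case False
    then have nt: "at x within ?I \<noteq> bot"
      using V x by (metis closure_def Un_iff mem_Collect_eq subsetD trivial_limit_within)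
    have "(h \<longlongrightarrow> h x) (at x within ?I)"
      using h(1) x interior_subset[of V] by (meson continuous_on_def tendsto_within_subset)
    then have "(frechet f \<longlongrightarrow> h x) (at x within ?I)"
      by (rule Lim_transform_eventually) (auto simp: eventually_at_filter h)
    then have "Lim (at x within ?I) (frechet f) = h x"
      using nt by (simp add: tendsto_Lim)
    with False show ?thesis by (simp add: deriv_on_def)
  qed
  then show "\<And>h x. continuous_on V h \<Longrightarrow> (\<And>z. z \<in> ?I \<Longrightarrow> h z = frechet f z) \<Longrightarrow>
           x \<in> V \<Longrightarrow> h x = deriv_on V f x"
    by blast
  obtain g where g: "uniformly_continuous_on (closure ?I) g" "\<And>x. x \<in> ?I \<Longrightarrow> frechet f x = g x"
    using uniformly_continuous_on_extension_on_closure[OF uc] by metis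
  then have cg: "continuous_on V g"
    using V uniformly_continuous_imp_continuous continuous_on_subset by blast
  have "g x = deriv_on V f x" if "x \<in> V" for x
    using ext[OF cg _ that] g(2) by simp
  with cg show "continuous_on V (deriv_on V f)"
    using continuous_on_cong by (metis (mono_tags, lifting))
qed

lemma cball_subset_closure_interior:
  fixes a :: "'a::real_normed_vector"
  assumes "r > 0"
  shows "cball a r \<subseteq> closure (interior (cball a r))"
proof -
  have "ball a r \<subseteq> interior (cball a r)"
    by (simp add: interior_maximal ball_subset_cball)
  then show ?thesis
    using closure_mono closure_ball[OF assms] by metis
qed

definition isomorphism_on :: "'a::real_normed_vector set \<Rightarrow> ('a \<Rightarrow>\<^sub>L 'b::real_normed_vector) \<Rightarrow> bool" where
  "isomorphism_on E T \<longleftrightarrow> (\<exists>c>0. \<forall>y\<in>E. norm (blinfun_apply T y) \<ge> c * norm y)"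

end

theory Submission
  imports Defs
begin

text \<open>The theorem splits into a linear and a nonlinear part. The linear part is Rosenthal's theorem: an
  operator on \<open>\<ell>\<^sub>\<infinity>(\<Gamma>)\<close> that keeps \<open>|\<Gamma>|\<close> many unit vectors away from zero is an isomorphism on
  \<open>\<ell>\<^sub>\<infinity>(\<Gamma>')\<close> for some \<open>\<Gamma>'\<close> of the same cardinality (\<open>rosenthal_isomorphism\<close>). It rests on the disjointness lemma
  \<open>disjoint_functionals\<close> and on norming functionals, which come from a Hahn-Banach argument with minimal
  sublinear functionals (\<open>norming_functional\<close>). It remains to find one point \<open>x\<close> of the ball at which
  \<open>dF(x)\<close> is bounded away from zero on \<open>|\<Gamma>|\<close> many unit vectors.

  The nonlinear part (\<open>large_derivatives_if_separated\<close>) finds such a point in the open ball. From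
  \<open>F(e\<^sub>\<gamma>)\<close> being far from \<open>F(0)\<close> one only gets, for each \<open>\<gamma>\<close>, a large derivative in direction \<open>e\<^sub>\<gamma>\<close>
  at a point depending on \<open>\<gamma>\<close>. If there were no common point, then, for some \<open>\<gamma>\<close>, both \<open>0\<close> and a point
  \<open>t e\<^sub>\<gamma>\<close> with \<open>t < 1\<close> close to 1 could be joined to the same vector by walks along which a functional
  norming \<open>F(t e\<^sub>\<gamma>) - F(0)\<close>, applied to \<open>F\<close>, hardly changes. The steps
  add multiples of characteristic functions of ever smaller sets of cardinality \<open>|\<Gamma>|\<close>. A single
  step moves many coordinates at once; the disjointness lemma makes their joint effect small, except for the
  coordinate \<open>\<gamma>\<close> itself, which is moved only in the walk from \<open>0\<close>, where its effect is small by assumption.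
  Uniform continuity of the derivative enters twice: it makes the linearisation error proportional to the
  length of the walk with an arbitrarily small factor, and it makes the derivative bounded, as needed for the
  disjointness lemma.\<close>

section \<open>Norming functionals\<close>

definition sublinear :: "('x::real_vector \<Rightarrow> real) \<Rightarrow> bool" where
  "sublinear p \<longleftrightarrow>
     (\<forall>x y. p (x + y) \<le> p x + p y) \<and> (\<forall>a x. a \<ge> 0 \<longrightarrow> p (a *\<^sub>R x) = a * p x)"

lemma sublinear_add: "sublinear p \<Longrightarrow> p (x + y) \<le> p x + p y"
  and sublinear_scale: "sublinear p \<Longrightarrow> a \<ge> 0 \<Longrightarrow> p (a *\<^sub>R x) = a * p x"
  by (auto simp: sublinear_def)

lemma sublinear_zero: "sublinear p \<Longrightarrow> p 0 = 0"
  using sublinear_scale[of p 0 0] by simp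

lemma sublinear_minus: "sublinear p \<Longrightarrow> - p (- x) \<le> p x"
  using sublinear_add[of p x "- x"] sublinear_zero[of p] by simp

lemma sublinearI:
  assumes add: "\<And>x y. p (x + y) \<le> p x + p y"
    and zero: "p 0 = 0"
    and scale: "\<And>a x. a > 0 \<Longrightarrow> p (a *\<^sub>R x) \<le> a * p x"
  shows "sublinear p"
  unfolding sublinear_def
proof (intro conjI allI impI)
  fix a :: real and x
  assume "a \<ge> 0"
  show "p (a *\<^sub>R x) = a * p x"
  proof (cases "a = 0")
    case False
    with \<open>a \<ge> 0\<close> have a: "a > 0" by simp
    have "p x \<le> inverse a * p (a *\<^sub>R x)"
      using scale[of "inverse a" "a *\<^sub>R x"] a by simp
    then have "a * p x \<le> p (a *\<^sub>R x)"
      using a by (simp add: field_simps)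
    with scale[OF a, of x] show ?thesis by simp
  qed (simp add: zero)
qed (rule add)

lemma sublinear_norm: "sublinear norm"
  by (rule sublinearI) (auto simp: norm_triangle_ineq)

text \<open>For sublinear \<open>p\<close>, this is the largest sublinear functional below \<open>p\<close> whose value at \<open>- v\<close> is at most
  \<open>- p v\<close>. It serves twice: a minimal \<open>p\<close> is not changed by it, which makes \<open>p\<close> additive; and every
  linear functional below the one obtained from \<open>p = norm\<close> norms \<open>v\<close>.\<close>

definition slide :: "('x::real_vector \<Rightarrow> real) \<Rightarrow> 'x \<Rightarrow> 'x \<Rightarrow> real" where
  "slide p v x = (INF t\<in>{0..}. p (x + t *\<^sub>R v) - t * p v)"

lemma slide_lower:
  assumes p: "sublinear p" and t: "t \<ge> 0"
  shows "slide p v x \<le> p (x + t *\<^sub>R v) - t * p v"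
proof -
  have "- p (- x) \<le> p (x + s *\<^sub>R v) - s * p v" if "s \<ge> 0" for s
    using sublinear_add[OF p, of "x + s *\<^sub>R v" "- x"] sublinear_scale[OF p that, of v] by simp
  then have "bdd_below ((\<lambda>t. p (x + t *\<^sub>R v) - t * p v) ` {0..})"
    by (intro bdd_belowI2[where m = "- p (- x)"]) auto
  then show ?thesis
    unfolding slide_def using t by (intro cINF_lower) auto
qed

lemma slide_greatest:
  assumes "\<And>t. t \<ge> 0 \<Longrightarrow> c \<le> p (x + t *\<^sub>R v) - t * p v"
  shows "c \<le> slide p v x"
  unfolding slide_def using assms by (intro cINF_greatest) auto

lemma slide_le: "sublinear p \<Longrightarrow> slide p v x \<le> p x"
  using slide_lower[of p 0 v x] by simp

lemma sublinear_slide: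
  assumes p: "sublinear p"
  shows "sublinear (slide p v)"
proof (rule sublinearI)
  fix x y
  have "slide p v (x + y) \<le> (p (x + s *\<^sub>R v) - s * p v) + (p (y + t *\<^sub>R v) - t * p v)"
    if "s \<ge> 0" "t \<ge> 0" for s t
  proof -
    have "slide p v (x + y) \<le> p (x + y + (s + t) *\<^sub>R v) - (s + t) * p v"
      using that by (intro slide_lower p) simp
    also have "x + y + (s + t) *\<^sub>R v = (x + s *\<^sub>R v) + (y + t *\<^sub>R v)"
      by (simp add: algebra_simps)
    finally show ?thesis
      using sublinear_add[OF p, of "x + s *\<^sub>R v" "y + t *\<^sub>R v"] by (simp add: algebra_simps)
  qed
  then have "slide p v (x + y) - (p (x + s *\<^sub>R v) - s * p v) \<le> slide p v y" if "s \<ge> 0" for s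
    using that by (intro slide_greatest) (simp add: diff_le_eq add.commute)
  then have "slide p v (x + y) - slide p v y \<le> p (x + s *\<^sub>R v) - s * p v" if "s \<ge> 0" for s
    using that by (simp add: algebra_simps)
  then show "slide p v (x + y) \<le> slide p v x + slide p v y"
    using slide_greatest[of "slide p v (x + y) - slide p v y" p x v] by simp
next
  have "p (0 + t *\<^sub>R v) - t * p v = 0" if "t \<ge> 0" for t
    using sublinear_scale[OF p that] by simp
  then show "slide p v 0 = 0"
    using slide_greatest[of 0 p 0 v] slide_lower[OF p, of 0 v 0] sublinear_zero[OF p] by auto
next
  fix a :: real and x assume a: "a > 0"
  have "slide p v (a *\<^sub>R x) \<le> a * (p (x + t *\<^sub>R v) - t * p v)" if "t \<ge> 0" for t
    using slide_lower[OF p, of "a * t" v "a *\<^sub>R x"] sublinear_scale[OF p, of a "x + t *\<^sub>R v"] a that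
    by (simp add: algebra_simps)
  then have "slide p v (a *\<^sub>R x) / a \<le> slide p v x"
    using a by (intro slide_greatest) (simp add: field_simps)
  then show "slide p v (a *\<^sub>R x) \<le> a * slide p v x"
    using a by (simp add: field_simps)
qed

lemma linear_if_minimal_sublinear:
  fixes p :: "'x::real_vector \<Rightarrow> real"
  assumes p: "sublinear p"
    and minimal: "\<And>q. sublinear q \<Longrightarrow> q \<le> p \<Longrightarrow> q = p"
  shows "linear p"
proof (rule linearI)
  have add: "p (x + v) = p x + p v" for x v
  proof -
    have "slide p v = p"
      using sublinear_slide[OF p] slide_le[OF p] by (intro minimal) (auto simp: le_fun_def)
    then have "p x \<le> p (x + 1 *\<^sub>R v) - 1 * p v"
      using slide_lower[OF p, of 1 v x] by simp
    with sublinear_add[OF p, of x v] show ?thesis by simp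
  qed
  then show "p (x + y) = p x + p y" for x y .
  have minus: "p (- x) = - p x" for x
    using add[of x "- x"] sublinear_zero[OF p] by simp
  show "p (a *\<^sub>R x) = a *\<^sub>R p x" for a x
    using sublinear_scale[OF p, of a x] sublinear_scale[OF p, of "- a" "- x"] minus
    by (cases "a \<ge> 0") auto
qed

text \<open>This is the analytic Hahn-Banach theorem in its algebraic form. Zorn's lemma is applied downwards to
  the sublinear functionals below \<open>q\<close>: the pointwise infimum of a chain exists because
  \<open>p x \<ge> - q (- x)\<close> for all of them, and it is subadditive because of any two members of the chain one
  is below the other.\<close>

lemma linear_below_sublinear:
  fixes q :: "'x::real_vector \<Rightarrow> real"
  assumes q: "sublinear q"
  obtains \<phi> where "linear \<phi>" "\<phi> \<le> q"
proof -
  define A where "A = {p. sublinear p \<and> p \<le> q}"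
  have "\<exists>m\<in>A. \<forall>p\<in>A. p \<le> m \<longrightarrow> p = m"
  proof (rule predicate_Zorn[where P = "\<lambda>a b. b \<le> a"])
    show "partial_order_on A (relation_of (\<lambda>a b. b \<le> a) A)"
      by (rule partial_order_on_relation_ofI) auto
  next
    fix C assume C: "C \<in> Chains (relation_of (\<lambda>a b. b \<le> a) A)"
    then have CA: "\<And>p. p \<in> C \<Longrightarrow> sublinear p \<and> p \<le> q"
      by (auto simp: Chains_def relation_of_def A_def)
    have total: "p \<le> r \<or> r \<le> p" if "p \<in> C" "r \<in> C" for p r
      using C that by (auto simp: Chains_def relation_of_def)
    show "\<exists>u\<in>A. \<forall>p\<in>C. u \<le> p"
    proof (cases "C = {}")
      case True
      with q show ?thesis by (auto simp: A_def)
    next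
      case False
      define u where "u x = (INF p\<in>C. p x)" for x
      have "- q (- x) \<le> p x" if "p \<in> C" for p x
        using CA[OF that] sublinear_minus[of p x] by (auto simp: le_fun_def intro: order_trans[rotated])
      then have bdd: "bdd_below ((\<lambda>p. p x) ` C)" for x
        by (intro bdd_belowI2[where m = "- q (- x)"])
      have lower: "u x \<le> p x" if "p \<in> C" for p x
        unfolding u_def using bdd that by (rule cINF_lower)
      have greatest: "c \<le> u x" if "\<And>p. p \<in> C \<Longrightarrow> c \<le> p x" for c x
        unfolding u_def using False that by (rule cINF_greatest)
      have "sublinear u"
      proof (rule sublinearI)
        fix x y
        have ub: "u (x + y) \<le> p x + r y" if pr: "p \<in> C" "r \<in> C" for p r
        proof -
          obtain s where s: "s \<in> C" "s \<le> p" "s \<le> r"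
            using total[OF pr] pr by auto
          then have "u (x + y) \<le> s x + s y"
            using lower[of s "x + y"] sublinear_add[of s x y] CA[of s] by auto
          also have "\<dots> \<le> p x + r y"
            using s by (auto simp: le_fun_def intro: add_mono)
          finally show ?thesis .
        qed
        have "u (x + y) - p x \<le> u y" if p: "p \<in> C" for p
        proof (rule greatest)
          show "u (x + y) - p x \<le> r y" if "r \<in> C" for r
            using ub[OF p that] by simp
        qed
        then have "u (x + y) - u y \<le> p x" if "p \<in> C" for p
          using that by (simp add: algebra_simps)
        then show "u (x + y) \<le> u x + u y"
          using greatest[of "u (x + y) - u y" x] by simp
      next
        have zero: "p 0 = 0" if "p \<in> C" for p
          using CA[OF that] sublinear_zero by blast
        have "0 \<le> u 0"
          by (rule greatest) (metis zero order_refl)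
        moreover obtain p where "p \<in> C" using False by blast
        ultimately show "u 0 = 0"
          using lower[of p 0] zero[of p] by simp
      next
        fix a :: real and x assume a: "a > 0"
        have "u (a *\<^sub>R x) \<le> a * p x" if "p \<in> C" for p
          using lower[OF that, of "a *\<^sub>R x"] CA[OF that] sublinear_scale[of p a x] a by simp
        then have "u (a *\<^sub>R x) / a \<le> u x"
          using a by (intro greatest) (simp add: field_simps)
        then show "u (a *\<^sub>R x) \<le> a * u x"
          using a by (simp add: field_simps)
      qed
      moreover have "u \<le> q"
      proof -
        obtain p where "p \<in> C" using False by blast
        with CA[OF this] lower[OF this] show ?thesis by (auto simp: le_fun_def intro: order_trans)
      qed
      ultimately show ?thesis
        using lower by (auto simp: A_def le_fun_def)
    qed
  qed
  then obtain m where m: "sublinear m" "m \<le> q"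
      and min: "\<And>p. sublinear p \<Longrightarrow> p \<le> q \<Longrightarrow> p \<le> m \<Longrightarrow> p = m"
    by (auto simp: A_def)
  have "linear m"
    using m min by (intro linear_if_minimal_sublinear) (auto intro: order_trans)
  with m show thesis by (auto intro: that)
qed

lemma norming_functional:
  fixes v :: "'x::real_normed_vector"
  obtains \<phi> :: "'x \<Rightarrow> real" where "linear \<phi>" "\<And>x. \<bar>\<phi> x\<bar> \<le> norm x" "\<phi> v = norm v"
proof -
  obtain \<phi> where lin: "linear \<phi>" and le: "\<phi> \<le> slide norm v"
    using linear_below_sublinear[OF sublinear_slide[OF sublinear_norm]] by blast
  have le_norm: "\<phi> x \<le> norm x" for x
    using le slide_le[OF sublinear_norm, of v x] by (auto simp: le_fun_def intro: order_trans)
  have bound: "\<bar>\<phi> x\<bar> \<le> norm x" for x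
    using le_norm[of x] le_norm[of "- x"] linear_neg[OF lin, of x] by auto
  have "\<phi> (- v) \<le> - norm v"
    using le slide_lower[OF sublinear_norm, of 1 v "- v"]
    by (auto simp: le_fun_def intro: order_trans)
  then have "\<phi> v = norm v"
    using le_norm[of v] linear_neg[OF lin, of v] by auto
  with lin bound show thesis by (rule that)
qed

section \<open>Coordinates of bounded functions\<close>

abbreviation coord :: "'g linf \<Rightarrow> 'g \<Rightarrow> real" where
  "coord y \<gamma> \<equiv> apply_bcontfun y (discrete \<gamma>)"

definition linf_of_fun :: "('g \<Rightarrow> real) \<Rightarrow> 'g linf" where
  "linf_of_fun f = Bcontfun (\<lambda>d. f (of_discrete d))"

lemma coord_linf_of_fun: "bounded (range f) \<Longrightarrow> coord (linf_of_fun f) \<gamma> = f \<gamma>"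
proof -
  assume "bounded (range f)"
  then have "bounded (range (\<lambda>d. f (of_discrete d)))"
    by (rule bounded_subset) auto
  then show ?thesis
    by (simp add: linf_of_fun_def Bcontfun_inverse all_bounded_in_bcontfun discrete_inverse)
qed

lemma coord_linf_of_fun_bound: "(\<And>\<gamma>. \<bar>f \<gamma>\<bar> \<le> b) \<Longrightarrow> coord (linf_of_fun f) \<gamma> = f \<gamma>"
  by (rule coord_linf_of_fun) (auto intro!: boundedI[where B = b])

lemma linf_eqI: "(\<And>\<gamma>. coord y \<gamma> = coord z \<gamma>) \<Longrightarrow> y = z"
  by (rule bcontfun_eqI) (metis of_discrete_inverse)

lemma norm_linf_le: "(\<And>\<gamma>. \<bar>coord y \<gamma>\<bar> \<le> b) \<Longrightarrow> norm y \<le> b"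
  by (rule norm_bound) (metis of_discrete_inverse real_norm_def)

lemma coord_le_norm: "\<bar>coord y \<gamma>\<bar> \<le> norm y"
  using norm_bounded[of y "discrete \<gamma>"] by simp

definition chi :: "'g set \<Rightarrow> 'g linf" where
  "chi A = linf_of_fun (indicator A)"

lemma coord_chi: "coord (chi A) \<gamma> = indicator A \<gamma>"
  unfolding chi_def by (rule coord_linf_of_fun_bound[where b = 1]) (auto simp: indicator_def)

lemma norm_chi_le: "norm (chi A) \<le> 1"
  by (rule norm_linf_le) (auto simp: coord_chi indicator_def)

lemma norm_unit_vec: "norm (unit_vec \<gamma>) = 1"
proof (rule antisym)
  show "norm (unit_vec \<gamma>) \<le> 1"
    by (rule norm_linf_le) (simp add: unit_vec_apply)
  show "1 \<le> norm (unit_vec \<gamma>)"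
    using coord_le_norm[of "unit_vec \<gamma>" \<gamma>] by (simp add: unit_vec_apply)
qed

lemma chi_remove: "\<gamma> \<in> A \<Longrightarrow> chi A = unit_vec \<gamma> + chi (A - {\<gamma>})"
  by (rule linf_eqI) (auto simp: coord_chi unit_vec_apply indicator_def)

lemma chi_in_linf_on: "chi A \<in> linf_on A"
  by (simp add: linf_on_def coord_chi)

lemma norm_disjoint_sum_le:
  assumes "y \<in> linf_on A" "z \<in> linf_on B" "A \<inter> B = {}" "norm y \<le> b" "norm z \<le> b"
  shows "norm (y + z) \<le> b"
proof (rule norm_linf_le)
  fix \<gamma>
  show "\<bar>coord (y + z) \<gamma>\<bar> \<le> b"
  proof (cases "\<gamma> \<in> A")
    case True
    then have "coord z \<gamma> = 0" using assms(2,3) by (auto simp: linf_on_def)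
    then show ?thesis using assms(4) coord_le_norm[of y \<gamma>] by simp
  next
    case False
    then have "coord y \<gamma> = 0" using assms(1) by (auto simp: linf_on_def)
    then show ?thesis using assms(5) coord_le_norm[of z \<gamma>] by simp
  qed
qed

section \<open>Index sets of full cardinality\<close>

text \<open>Cardinality is expressed by an injection of the type into \<open>A\<close>, because the map itself is what the
  constructions use: to cut \<open>A\<close> into pieces and to embed the bounded functions into those supported in
  \<open>A\<close>.\<close>

definition full :: "'g set \<Rightarrow> bool" where
  "full A \<longleftrightarrow> (\<exists>f::'g \<Rightarrow> 'g. inj f \<and> range f \<subseteq> A)"

lemma full_iff_card: "full (A :: 'g set) \<longleftrightarrow> |A| =o |UNIV :: 'g set|"
proof -
  have "full A \<longleftrightarrow> |UNIV :: 'g set| \<le>o |A|"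
    by (simp add: full_def card_of_ordLeq[symmetric])
  then show ?thesis
    using card_of_mono1[of A UNIV] by (auto simp: ordIso_iff_ordLeq)
qed

lemma full_UNIV: "full UNIV"
  by (auto simp: full_def intro: exI[of _ id])

lemma full_mono: "full A \<Longrightarrow> A \<subseteq> B \<Longrightarrow> full B"
  by (auto simp: full_def)

lemma full_nonempty: "full A \<Longrightarrow> A \<noteq> {}"
  by (auto simp: full_def)

lemma full_diff:
  assumes inf: "infinite (UNIV :: 'g set)" and A: "full (A :: 'g set)" and B: "\<not> full (A \<inter> B)"
  shows "full (A - B)"
proof (rule ccontr)
  assume "\<not> full (A - B)"
  moreover have less: "|C| <o |UNIV :: 'g set|" if "\<not> full C" for C :: "'g set"
    using that card_of_ordLess[of "UNIV :: 'g set" C] by (simp add: full_def)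
  ultimately have "|(A - B) \<union> (A \<inter> B)| <o |UNIV :: 'g set|"
    using B inf by (intro card_of_Un_ordLess_infinite) auto
  moreover have "(A - B) \<union> (A \<inter> B) = A" by auto
  ultimately have "|A| <o |UNIV :: 'g set|" by simp
  with A show False
    using not_ordLess_ordIso full_iff_card by blast
qed

lemma full_partition:
  assumes inf: "infinite (UNIV :: 'g set)" and A: "full (A :: 'g set)"
  obtains P :: "'g \<Rightarrow> 'g set"
  where "\<And>i. full (P i)" "\<And>i. P i \<subseteq> A" "\<And>i j. i \<noteq> j \<Longrightarrow> P i \<inter> P j = {}"
proof -
  obtain f :: "'g \<Rightarrow> 'g" where f: "inj f" "range f \<subseteq> A"
    using A by (auto simp: full_def)
  have "|(UNIV :: 'g set) \<times> (UNIV :: 'g set)| \<le>o |UNIV :: 'g set|"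
    using card_of_Times_same_infinite[OF inf] by (rule ordIso_imp_ordLeq)
  then obtain p :: "'g \<times> 'g \<Rightarrow> 'g" where p: "inj p"
    by (auto simp: card_of_ordLeq[symmetric])
  define P where "P i = range (\<lambda>k. f (p (i, k)))" for i
  have fp: "f (p x) = f (p y) \<Longrightarrow> x = y" for x y
    using injD[OF f(1)] injD[OF p] by blast
  have "inj (\<lambda>k. f (p (i, k)))" for i
    by (rule injI) (use fp in blast)
  then have "full (P i)" for i
    unfolding full_def P_def by blast
  moreover have "P i \<subseteq> A" for i
    using f by (auto simp: P_def)
  moreover have "P i \<inter> P j = {}" if "i \<noteq> j" for i j
  proof -
    have "f (p (i, k)) \<noteq> f (p (j, l))" for k l
      using fp[of "(i, k)" "(j, l)"] that by auto
    then show ?thesis by (auto simp: P_def)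
  qed
  ultimately show thesis by (rule that)
qed

section \<open>Rosenthal's theorem\<close>

text \<open>A functional on a supremum-norm space acts like an additive set function: since the norm of a sum of
  disjointly supported vectors is the larger of the two norms, what the functional does on disjoint
  sets of coordinates adds up against a single bound.\<close>

lemma functional_disjoint_sum:
  fixes \<mu> :: "'g linf \<Rightarrow> real"
  assumes \<mu>: "linear \<mu>" and bound: "\<And>y. y \<in> linf_on (A \<union> B) \<Longrightarrow> \<bar>\<mu> y\<bar> \<le> c * norm y"
    and y: "y \<in> linf_on A" "norm y \<le> b" and z: "z \<in> linf_on B" "norm z \<le> b"
    and disj: "A \<inter> B = {}" and c: "c \<ge> 0"
  shows "\<bar>\<mu> y\<bar> + \<bar>\<mu> z\<bar> \<le> c * b"
proof -
  have "\<bar>\<mu> y + \<mu> w\<bar> \<le> c * b" if w: "w \<in> linf_on B" "norm w \<le> b" for w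
  proof -
    have "y + w \<in> linf_on (A \<union> B)"
      using y w by (auto simp: linf_on_def)
    then have "\<bar>\<mu> (y + w)\<bar> \<le> c * norm (y + w)"
      by (rule bound)
    also have "\<dots> \<le> c * b"
      using norm_disjoint_sum_le[OF y(1) w(1) disj y(2) w(2)] c by (rule mult_left_mono)
    finally show ?thesis
      by (simp add: linear_add[OF \<mu>])
  qed
  from this[of z] this[of "- z"] show ?thesis
    using z by (auto simp: linf_on_def linear_neg[OF \<mu>])
qed

text \<open>Rosenthal's disjointness lemma. Split \<open>A\<close> into as many full pieces as there are
  indices. If one of the pieces does not work, it contains an index whose functional has more than \<open>\<epsilon>\<close> of its norm on the rest of the piece; if none
  works, these exceptional indices, one from each piece, form a full set. The rest of each piece is
  disjoint from that set, so on the coordinates in that set the chosen functionals have norms smaller by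
  \<open>\<epsilon>\<close>. This can be repeated only finitely often.\<close>

lemma disjoint_functionals:
  fixes \<mu> :: "'g \<Rightarrow> 'g linf \<Rightarrow> real"
  assumes inf: "infinite (UNIV :: 'g set)" and lin: "\<And>\<gamma>. linear (\<mu> \<gamma>)" and \<epsilon>: "\<epsilon> > 0"
    and bound: "\<And>\<gamma> y. \<bar>\<mu> \<gamma> y\<bar> \<le> L * norm y" and A: "full A"
  obtains B where "full B" "B \<subseteq> A"
    "\<And>\<gamma> y. \<gamma> \<in> B \<Longrightarrow> y \<in> linf_on (B - {\<gamma>}) \<Longrightarrow> \<bar>\<mu> \<gamma> y\<bar> \<le> \<epsilon> * norm y"
proof -
  have iter: "\<exists>B. full B \<and> B \<subseteq> A \<and>
          (\<forall>\<gamma>\<in>B. \<forall>y\<in>linf_on (B - {\<gamma>}). \<bar>\<mu> \<gamma> y\<bar> \<le> \<epsilon> * norm y)"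
    if "full A" "\<And>\<gamma> y. \<gamma> \<in> A \<Longrightarrow> y \<in> linf_on A \<Longrightarrow> \<bar>\<mu> \<gamma> y\<bar> \<le> real n * \<epsilon> * norm y" for n A
    using that
  proof (induction n arbitrary: A)
    case 0
    have "\<bar>\<mu> \<gamma> y\<bar> \<le> \<epsilon> * norm y" if "\<gamma> \<in> A" "y \<in> linf_on (A - {\<gamma>})" for \<gamma> y
    proof -
      have "y \<in> linf_on A" using that by (auto simp: linf_on_def)
      then have "\<bar>\<mu> \<gamma> y\<bar> \<le> 0" using 0(2)[OF that(1)] by simp
      also have "0 \<le> \<epsilon> * norm y" using \<epsilon> by simp
      finally show ?thesis .
    qed
    with \<open>full A\<close> show ?case by blast
  next
    case (Suc n)
    obtain P :: "'g \<Rightarrow> 'g set" where P: "\<And>i. full (P i)" "\<And>i. P i \<subseteq> A"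
        and disj: "\<And>i j. i \<noteq> j \<Longrightarrow> P i \<inter> P j = {}"
      using full_partition[OF inf \<open>full A\<close>] by metis
    show ?case
    proof (cases "\<exists>i. \<forall>\<gamma>\<in>P i. \<forall>y\<in>linf_on (P i - {\<gamma>}). \<bar>\<mu> \<gamma> y\<bar> \<le> \<epsilon> * norm y")
      case True
      with P show ?thesis by blast
    next
      case False
      \<comment> \<open>\<open>g i\<close> is the exceptional index of the piece \<open>P i\<close>, and \<open>y i\<close> witnesses the excess.\<close>
      then have "\<forall>i. \<exists>\<gamma> y. \<gamma> \<in> P i \<and> y \<in> linf_on (P i - {\<gamma>}) \<and> \<bar>\<mu> \<gamma> y\<bar> > \<epsilon> * norm y"
        by (meson not_le)
      then obtain g y where g: "\<And>i. g i \<in> P i" and y: "\<And>i. y i \<in> linf_on (P i - {g i})"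
          and big: "\<And>i. \<bar>\<mu> (g i) (y i)\<bar> > \<epsilon> * norm (y i)"
        by metis
      have g_inj: "g i = g j \<Longrightarrow> i = j" for i j
        using g[of i] g[of j] disj[of i j] by (metis disjoint_iff)
      then have "inj g" by (rule injI)
      then have full: "full (range g)" by (auto simp: full_def)
      have sub: "range g \<subseteq> A" using g P by blast
      have "\<bar>\<mu> \<gamma> z\<bar> \<le> real n * \<epsilon> * norm z" if \<gamma>: "\<gamma> \<in> range g" and z: "z \<in> linf_on (range g)" for \<gamma> z
      proof -
        obtain i where i: "\<gamma> = g i" using \<gamma> by blast
        have y0: "norm (y i) > 0"
          using big[of i] linear_0[OF lin] by (cases "y i = 0") auto
        \<comment> \<open>Rescaled to the norm of \<open>z\<close>, the witness and \<open>z\<close> share one bound for their sum.\<close>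
        define w where "w = (norm z / norm (y i)) *\<^sub>R y i"
        have w: "w \<in> linf_on (P i - {g i})" "norm w \<le> norm z"
          using y[of i] y0 by (auto simp: w_def linf_on_def)
        have "g j \<notin> P i - {g i}" for j
          using g[of j] disj[of i j] by (cases "i = j") auto
        then have away: "(P i - {g i}) \<inter> range g = {}" by auto
        have "\<bar>\<mu> \<gamma> w\<bar> + \<bar>\<mu> \<gamma> z\<bar> \<le> (real (Suc n) * \<epsilon>) * norm z"
        proof (rule functional_disjoint_sum[OF lin _ w z order_refl away])
          fix u assume "u \<in> linf_on (P i - {g i} \<union> range g)"
          then have "u \<in> linf_on A"
            using P(2)[of i] sub by (auto simp: linf_on_def)
          then show "\<bar>\<mu> \<gamma> u\<bar> \<le> real (Suc n) * \<epsilon> * norm u"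
            using \<gamma> sub by (intro Suc.prems) auto
        qed (use \<epsilon> in auto)
        moreover have "\<epsilon> * norm z \<le> \<bar>\<mu> \<gamma> w\<bar>"
        proof -
          have "\<epsilon> * norm z = (norm z / norm (y i)) * (\<epsilon> * norm (y i))"
            using y0 by simp
          also have "\<dots> \<le> (norm z / norm (y i)) * \<bar>\<mu> \<gamma> (y i)\<bar>"
            using big[of i] i by (intro mult_left_mono) auto
          also have "\<dots> = \<bar>\<mu> \<gamma> w\<bar>"
            by (simp add: w_def linear_scale[OF lin] abs_mult)
          finally show ?thesis .
        qed
        ultimately show ?thesis by (simp add: algebra_simps)
      qed
      from Suc.IH[OF full this] sub show ?thesis by blast
    qed
  qed
  obtain n :: nat where n: "L \<le> real n * \<epsilon>"
    using reals_Archimedean3[OF \<epsilon>] by (meson less_imp_le)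
  have "\<bar>\<mu> \<gamma> y\<bar> \<le> real n * \<epsilon> * norm y" for \<gamma> y
    using bound[of \<gamma> y] mult_right_mono[OF n, of "norm y"] by simp
  from iter[OF A this] show thesis using that by blast
qed

text \<open>Norm each \<open>T (unit_vec \<gamma>)\<close> by a functional and pull the functionals back along \<open>T\<close>. On the set supplied by
  Rosenthal's lemma the functional of index \<open>\<gamma>\<close> nearly reads off the coordinate \<open>\<gamma>\<close>, so the norm of
  \<open>T y\<close> controls every coordinate of \<open>y\<close> up to an error of half the norm of \<open>y\<close>.\<close>

theorem rosenthal_isomorphism:
  fixes T :: "'g linf \<Rightarrow>\<^sub>L 'x::real_normed_vector"
  assumes inf: "infinite (UNIV :: 'g set)" and c: "c > 0"
    and large: "full {\<gamma>. c \<le> norm (T (unit_vec \<gamma>))}"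
  obtains G where "full G" "isomorphism_on (linf_on G) T"
proof -
  have "\<exists>\<phi> :: 'x \<Rightarrow> real. linear \<phi> \<and> (\<forall>x. \<bar>\<phi> x\<bar> \<le> norm x) \<and>
      \<phi> (T (unit_vec \<gamma>)) = norm (T (unit_vec \<gamma>))" for \<gamma>
    by (rule norming_functional) blast
  then obtain \<phi> :: "'g \<Rightarrow> 'x \<Rightarrow> real" where lin: "\<And>\<gamma>. linear (\<phi> \<gamma>)"
      and \<phi>_le: "\<And>\<gamma> x. \<bar>\<phi> \<gamma> x\<bar> \<le> norm x"
      and \<phi>_eq: "\<And>\<gamma>. \<phi> \<gamma> (T (unit_vec \<gamma>)) = norm (T (unit_vec \<gamma>))"
    by metis
  have T_lin: "linear (\<lambda>y. \<phi> \<gamma> (T y))" for \<gamma>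
    by (rule linearI) (simp_all add: blinfun.add_right blinfun.scaleR_right
        linear_add[OF lin] linear_scale[OF lin])
  have "\<bar>\<phi> \<gamma> (T y)\<bar> \<le> norm T * norm y" for \<gamma> y
    using \<phi>_le[of \<gamma> "T y"] norm_blinfun[of T y] by simp
  then obtain G where G: "full G" "G \<subseteq> {\<gamma>. c \<le> norm (T (unit_vec \<gamma>))}"
      and small: "\<And>\<gamma> y. \<gamma> \<in> G \<Longrightarrow> y \<in> linf_on (G - {\<gamma>}) \<Longrightarrow> \<bar>\<phi> \<gamma> (T y)\<bar> \<le> c / 2 * norm y"
    using disjoint_functionals[of "\<lambda>\<gamma> y. \<phi> \<gamma> (T y)" "c / 2" "norm T", OF inf T_lin _ _ large] c
    by (metis half_gt_zero)
  have "c / 2 * norm y \<le> norm (T y)" if y: "y \<in> linf_on G" for y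
  proof -
    have "\<bar>coord y \<gamma>\<bar> \<le> norm (T y) / c + norm y / 2" for \<gamma>
    proof (cases "\<gamma> \<in> G")
      case True
      \<comment> \<open>The part of \<open>y\<close> that the functional of index \<open>\<gamma>\<close> almost ignores.\<close>
      define z where "z = y - coord y \<gamma> *\<^sub>R unit_vec \<gamma>"
      have coord_z: "coord z \<delta> = (if \<delta> = \<gamma> then 0 else coord y \<delta>)" for \<delta>
        by (simp add: z_def unit_vec_apply)
      have "z \<in> linf_on (G - {\<gamma>})"
        using y by (auto simp: linf_on_def coord_z)
      moreover have "norm z \<le> norm y"
        by (rule norm_linf_le) (simp add: coord_z coord_le_norm)
      ultimately have z_small: "\<bar>\<phi> \<gamma> (T z)\<bar> \<le> c / 2 * norm y"
        using small[OF True, of z] c by (smt (verit) mult_left_mono half_gt_zero)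
      have "c * \<bar>coord y \<gamma>\<bar> \<le> norm (T (unit_vec \<gamma>)) * \<bar>coord y \<gamma>\<bar>"
        using G True by (intro mult_right_mono) auto
      also have "\<dots> = \<bar>\<phi> \<gamma> (T (coord y \<gamma> *\<^sub>R unit_vec \<gamma>))\<bar>"
        by (simp add: blinfun.scaleR_right linear_scale[OF lin] \<phi>_eq abs_mult)
      also have "\<phi> \<gamma> (T (coord y \<gamma> *\<^sub>R unit_vec \<gamma>)) = \<phi> \<gamma> (T y) - \<phi> \<gamma> (T z)"
        by (simp add: z_def blinfun.diff_right linear_diff[OF lin])
      also have "\<bar>\<dots>\<bar> \<le> norm (T y) + c / 2 * norm y"
        using \<phi>_le[of \<gamma> "T y"] z_small by linarith
      finally show ?thesis
        using c by (simp add: field_simps)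
    next
      case False
      with y have "coord y \<gamma> = 0" by (auto simp: linf_on_def)
      then show ?thesis using c by simp
    qed
    then have "norm y \<le> norm (T y) / c + norm y / 2"
      by (rule norm_linf_le)
    then show ?thesis
      using c by (simp add: field_simps)
  qed
  then have "isomorphism_on (linf_on G) T"
    unfolding isomorphism_on_def using c by (intro exI[of _ "c / 2"]) auto
  with G(1) show thesis by (rule that)
qed

lemma linf_embedding:
  assumes "full (G :: 'g set)"
  obtains E :: "'g linf \<Rightarrow>\<^sub>L 'g linf"
  where "\<And>y. norm (E y) = norm y" "\<And>y. E y \<in> linf_on G"
proof -
  obtain b :: "'g \<Rightarrow> 'g" where b: "inj b" "range b \<subseteq> G"
    using assms by (auto simp: full_def)
  define e where "e y = linf_of_fun (\<lambda>\<gamma>. if \<gamma> \<in> range b then coord y (inv b \<gamma>) else 0)" for y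
  have coord_e: "coord (e y) \<gamma> = (if \<gamma> \<in> range b then coord y (inv b \<gamma>) else 0)" for y \<gamma>
    unfolding e_def by (rule coord_linf_of_fun_bound[where b = "norm y"]) (simp add: coord_le_norm)
  have e_le: "norm (e y) \<le> norm y" for y
    by (rule norm_linf_le) (simp add: coord_e coord_le_norm)
  have "bounded_linear e"
  proof (rule bounded_linear_intro[where K = 1])
    show "e (y + z) = e y + e z" for y z
      by (rule linf_eqI) (simp add: coord_e)
    show "e (r *\<^sub>R y) = r *\<^sub>R e y" for r y
      by (rule linf_eqI) (simp add: coord_e)
    show "norm (e y) \<le> norm y * 1" for y
      using e_le by simp
  qed
  then have E: "blinfun_apply (Blinfun e) = e"
    by (rule bounded_linear_Blinfun_apply)
  have "norm y \<le> norm (e y)" for y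
  proof (rule norm_linf_le)
    show "\<bar>coord y \<gamma>\<bar> \<le> norm (e y)" for \<gamma>
      using coord_le_norm[of "e y" "b \<gamma>"] b(1) by (simp add: coord_e)
  qed
  with e_le have "norm (Blinfun e y) = norm y" for y
    by (simp add: E antisym)
  moreover have "Blinfun e y \<in> linf_on G" for y
    using b(2) by (auto simp: E linf_on_def coord_e)
  ultimately show thesis by (rule that)
qed

section \<open>Mean value estimates on the unit ball\<close>

text \<open>The segment from the centre to any point of the ball can be divided into a fixed number of steps on
  each of which \<open>f\<close> varies by less than 1.\<close>

lemma bounded_if_uniformly_continuous_on_ball:
  fixes f :: "'a::real_normed_vector \<Rightarrow> 'b::real_normed_vector"
  assumes "uniformly_continuous_on (ball 0 1) f"
  obtains L where "L > 0" "\<And>x. x \<in> ball 0 1 \<Longrightarrow> norm (f x) \<le> L"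
proof -
  obtain d where d: "d > 0"
      and close: "\<And>x y. x \<in> ball 0 1 \<Longrightarrow> y \<in> ball 0 1 \<Longrightarrow> dist y x < d \<Longrightarrow> dist (f y) (f x) < 1"
    using assms unfolding uniformly_continuous_on_def by (meson zero_less_one)
  obtain N :: nat where N: "N > 0" "1 / real N < d"
    using d by (metis nat_approx_posE zero_less_Suc)
  have "norm (f x) \<le> real N + norm (f 0)" if x: "x \<in> ball 0 1" for x
  proof -
    have inside: "(real k / real N) *\<^sub>R x \<in> ball 0 1" if "k \<le> N" for k
    proof -
      have "real k / real N * norm x \<le> 1 * norm x"
        using that N(1) by (intro mult_right_mono) (auto simp: field_simps)
      with x show ?thesis by simp
    qed
    have "dist (f ((real k / real N) *\<^sub>R x)) (f 0) \<le> real k" if "k \<le> N" for k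
      using that
    proof (induction k)
      case (Suc k)
      have "(real (Suc k) / real N) *\<^sub>R x - (real k / real N) *\<^sub>R x = (1 / real N) *\<^sub>R x"
        by (simp add: scaleR_diff_left[symmetric] diff_divide_distrib[symmetric])
      then have "dist ((real (Suc k) / real N) *\<^sub>R x) ((real k / real N) *\<^sub>R x) = 1 / real N * norm x"
        by (simp add: dist_norm)
      also have "\<dots> \<le> 1 / real N * 1"
        using x by (intro mult_left_mono) auto
      also have "\<dots> < d" using N by simp
      finally have "dist (f ((real (Suc k) / real N) *\<^sub>R x)) (f ((real k / real N) *\<^sub>R x)) < 1"
        using Suc.prems by (intro close inside) auto
      moreover have "dist (f ((real k / real N) *\<^sub>R x)) (f 0) \<le> real k"
        using Suc by simp
      ultimately show ?case
        using dist_triangle[of "f ((real (Suc k) / real N) *\<^sub>R x)" "f 0" "f ((real k / real N) *\<^sub>R x)"]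
        by simp
    qed simp
    from this[of N] have "norm (f x - f 0) \<le> real N"
      using N(1) by (simp add: dist_norm)
    then show ?thesis
      using norm_triangle_ineq[of "f x - f 0" "f 0"] by simp
  qed
  moreover have "real N + norm (f 0) > 0"
    using N(1) by (simp add: add_pos_nonneg)
  ultimately show thesis using that by blast
qed

lemma linearization_error:
  fixes F :: "'a::real_normed_vector \<Rightarrow> 'b::real_normed_vector"
  assumes der: "\<And>x. x \<in> ball 0 1 \<Longrightarrow> (F has_derivative blinfun_apply (D x)) (at x)"
    and close: "\<And>v w. v \<in> ball 0 1 \<Longrightarrow> w \<in> ball 0 1 \<Longrightarrow> dist v w \<le> r \<Longrightarrow> norm (D v - D w) \<le> \<epsilon>"
    and x: "x \<in> ball 0 1" "x + u \<in> ball 0 1" and u: "norm u \<le> r"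
  shows "norm (F (x + u) - F x - D x u) \<le> norm u * \<epsilon>"
proof -
  let ?S = "closed_segment x (x + u)"
  have sub: "?S \<subseteq> ball 0 1"
    using x by (intro closed_segment_subset) auto
  have near: "dist z x \<le> r" if "z \<in> ?S" for z
    using segment_bound1[OF that] u by (simp add: dist_norm norm_minus_commute)
  have "norm (F (x + u) - F x - D x (x + u - x)) \<le> norm (x + u - x) * \<epsilon>"
  proof (rule differentiable_bound_linearization[where S = ?S])
    show "x + t *\<^sub>R (x + u - x) \<in> ?S" if "t \<in> {0..1}" for t
      using that by (auto simp: in_segment algebra_simps intro!: exI[of _ t])
    show "(F has_derivative blinfun_apply (D z)) (at z within ?S)" if "z \<in> ?S" for z
      using der sub that by (blast intro: has_derivative_at_withinI)
    show "onorm (blinfun_apply (D z) - blinfun_apply (D x)) \<le> \<epsilon>" if "z \<in> ?S" for z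
    proof -
      have "norm (D z - D x) \<le> \<epsilon>"
        using sub that x near[OF that] by (intro close) auto
      then show ?thesis
        by (simp add: norm_blinfun.rep_eq minus_blinfun.rep_eq fun_diff_def)
    qed
  qed simp
  then show ?thesis by simp
qed

text \<open>The point \<open>e\<close> may lie on the unit sphere, where \<open>F\<close> is merely continuous, so the mean value estimate is
  made on the segment from \<open>t e\<close> to \<open>e\<close> and uses derivatives only in its interior.\<close>

lemma radial_increment_bound:
  fixes F :: "'a::real_normed_vector \<Rightarrow> 'b::real_normed_vector"
  assumes cont: "continuous_on (cball 0 1) F"
    and der: "\<And>x. x \<in> ball 0 1 \<Longrightarrow> (F has_derivative blinfun_apply (D x)) (at x)"
    and bound: "\<And>x. x \<in> ball 0 1 \<Longrightarrow> norm (D x) \<le> L"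
    and e: "norm e \<le> 1" and t: "0 < t" "t < 1"
  shows "norm (F e - F (t *\<^sub>R e)) \<le> L * (1 - t)"
proof -
  have cball: "s *\<^sub>R e \<in> cball 0 1" if "t \<le> s" "s \<le> 1" for s
    using mult_mono[of s 1 "norm e" 1] that t e by simp
  have ball: "s *\<^sub>R e \<in> ball 0 1" if "t < s" "s < 1" for s
  proof -
    have "s * norm e \<le> s * 1"
      using that t e by (intro mult_left_mono) auto
    also have "\<dots> < 1"
      using that by simp
    finally show ?thesis
      using that t by simp
  qed
  have "norm (F (1 *\<^sub>R e) - F (t *\<^sub>R e)) \<le> L * 1 - L * t"
  proof (rule differentiable_bound_general[where f = "\<lambda>s. F (s *\<^sub>R e)" and \<phi> = "\<lambda>s. L * s"
        and f' = "\<lambda>s. D (s *\<^sub>R e) e" and \<phi>' = "\<lambda>_. L"])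
    show "continuous_on {t..1} (\<lambda>s. F (s *\<^sub>R e))"
      using cball by (intro continuous_on_compose2[OF cont] continuous_intros) auto
    show "((\<lambda>s. F (s *\<^sub>R e)) has_vector_derivative D (s *\<^sub>R e) e) (at s)" if "t < s" "s < 1" for s
    proof -
      have "((\<lambda>s. F (s *\<^sub>R e)) has_derivative (\<lambda>h. D (s *\<^sub>R e) (h *\<^sub>R e))) (at s)"
        using ball[OF that] by (intro has_derivative_compose[OF _ der]) (auto intro!: derivative_eq_intros)
      then show ?thesis
        by (simp add: has_vector_derivative_def blinfun.scaleR_right)
    qed
    show "((*) L has_vector_derivative L) (at s)" for s
      by (auto simp: has_vector_derivative_def mult.commute intro!: derivative_eq_intros)
    show "norm (D (s *\<^sub>R e) e) \<le> L" if "t < s" "s < 1" for s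
    proof -
      have "norm (D (s *\<^sub>R e) e) \<le> norm (D (s *\<^sub>R e)) * norm e"
        by (rule norm_blinfun)
      also have "\<dots> \<le> norm (D (s *\<^sub>R e)) * 1"
        using e by (intro mult_left_mono) auto
      also have "\<dots> \<le> L"
        using bound[OF ball[OF that]] by simp
      finally show ?thesis .
    qed
  qed (use t in \<open>auto intro!: continuous_intros\<close>)
  then show ?thesis by (simp add: algebra_simps)
qed

section \<open>Derivatives that are large on many unit vectors\<close>

text \<open>Suppose that no derivative is large on a full set of unit vectors. Walk from \<open>0\<close> in steps of height \<open>h\<close>
  over characteristic functions of decreasing full sets, \<open>x = h (chi A\<^sub>1 + ... + chi A\<^sub>j)\<close>, and at the same
  time, for each index \<open>\<gamma>\<close>, walk from \<open>t e\<^sub>\<gamma>\<close> over the same sets with \<open>\<gamma>\<close> removed. After \<open>t / h\<close> steps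
  both walks are at the same point. Let \<open>f\<^sub>\<gamma>\<close> be \<open>F\<close> followed by a functional that norms
  \<open>F (t e\<^sub>\<gamma>) - F 0\<close>. By Rosenthal's lemma, the next set can be chosen such that the derivatives of \<open>f\<^sub>\<gamma>\<close>
  at the current points of both walks almost vanish on it away from \<open>\<gamma>\<close>, and by the assumption such that
  the derivative in direction \<open>e\<^sub>\<gamma>\<close> is small at \<open>x\<close>. Then \<open>f\<^sub>\<gamma>\<close> changes along both walks by a small
  multiple of the height, for those \<open>\<gamma>\<close> that lie in the last set. This contradicts the separation of
  \<open>f\<^sub>\<gamma> (t e\<^sub>\<gamma>)\<close> from \<open>f\<^sub>\<gamma> 0\<close>.\<close>

lemma large_derivatives_if_separated:
  fixes F :: "'g linf \<Rightarrow> 'x::real_normed_vector" and D :: "'g linf \<Rightarrow> 'g linf \<Rightarrow>\<^sub>L 'x"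
  assumes inf: "infinite (UNIV :: 'g set)"
    and der: "\<And>x. x \<in> ball 0 1 \<Longrightarrow> (F has_derivative blinfun_apply (D x)) (at x)"
    and uc: "uniformly_continuous_on (ball 0 1) D"
    and t: "0 < t" "t < 1" and \<delta>: "\<delta> > 0"
    and far: "\<And>\<gamma>. \<delta> \<le> norm (F (t *\<^sub>R unit_vec \<gamma>) - F 0)"
  shows "\<exists>x\<in>ball 0 1. full {\<gamma>. \<delta> / 4 \<le> norm (D x (unit_vec \<gamma>))}"
proof (rule ccontr)
  assume contra: "\<not> ?thesis"
  \<comment> \<open>The walks change \<open>f\<close> by at most \<open>\<delta> / 4 + 2 \<epsilon>\<close> and \<open>2 \<epsilon>\<close>; these must add up to less than \<open>\<delta>\<close>.\<close>
  define \<epsilon> where "\<epsilon> = \<delta> / 8"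
  have \<epsilon>: "\<epsilon> > 0" using \<delta> by (simp add: \<epsilon>_def)
  obtain L where L: "\<And>x. x \<in> ball 0 1 \<Longrightarrow> norm (D x) \<le> L"
    using bounded_if_uniformly_continuous_on_ball[OF uc] by metis
  obtain d where d: "d > 0"
      and close: "\<And>v w. v \<in> ball 0 1 \<Longrightarrow> w \<in> ball 0 1 \<Longrightarrow> dist w v < d \<Longrightarrow> dist (D w) (D v) < \<epsilon>"
    using uc \<epsilon> unfolding uniformly_continuous_on_def by metis
  obtain K :: nat where K: "K > 0" "1 / real K < d"
    using d by (metis nat_approx_posE zero_less_Suc)
  define h where "h = t / real K"
  have Kh: "real K * h = t" using K(1) by (simp add: h_def)
  have h: "h > 0" using t K(1) by (simp add: h_def)
  have "h \<le> 1 / real K" using t by (auto simp: h_def intro: divide_right_mono)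
  with K(2) have "h < d" by simp
  then have D_close: "norm (D v - D w) \<le> \<epsilon>"
    if "v \<in> ball 0 1" "w \<in> ball 0 1" "dist v w \<le> h" for v w
    using close[OF that(2) that(1)] that(3) by (simp add: dist_norm)
  have "\<exists>\<phi> :: 'x \<Rightarrow> real. linear \<phi> \<and> (\<forall>x. \<bar>\<phi> x\<bar> \<le> norm x) \<and>
      \<phi> (F (t *\<^sub>R unit_vec \<gamma>) - F 0) = norm (F (t *\<^sub>R unit_vec \<gamma>) - F 0)" for \<gamma>
    by (rule norming_functional) blast
  then obtain \<phi> :: "'g \<Rightarrow> 'x \<Rightarrow> real" where lin: "\<And>\<gamma>. linear (\<phi> \<gamma>)"
      and \<phi>_le: "\<And>\<gamma> x. \<bar>\<phi> \<gamma> x\<bar> \<le> norm x"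
      and \<phi>_eq: "\<And>\<gamma>. \<phi> \<gamma> (F (t *\<^sub>R unit_vec \<gamma>) - F 0) = norm (F (t *\<^sub>R unit_vec \<gamma>) - F 0)"
    by metis
  define f where "f \<gamma> x = \<phi> \<gamma> (F x)" for \<gamma> x
  have increment: "\<bar>f \<gamma> (x + h *\<^sub>R u) - f \<gamma> x\<bar> \<le> h * (\<bar>\<phi> \<gamma> (D x u)\<bar> + \<epsilon>)"
    if "x \<in> ball 0 1" "x + h *\<^sub>R u \<in> ball 0 1" "norm u \<le> 1" for \<gamma> x u
  proof -
    have hu: "norm (h *\<^sub>R u) \<le> h"
      using that(3) h by simp
    have "norm (F (x + h *\<^sub>R u) - F x - D x (h *\<^sub>R u)) \<le> norm (h *\<^sub>R u) * \<epsilon>"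
      using linearization_error[OF der D_close that(1,2) hu] .
    also have "\<dots> \<le> h * \<epsilon>"
      using hu \<epsilon> by (intro mult_right_mono) auto
    finally have "\<bar>\<phi> \<gamma> (F (x + h *\<^sub>R u) - F x - D x (h *\<^sub>R u))\<bar> \<le> h * \<epsilon>"
      using \<phi>_le order_trans by blast
    moreover have "\<phi> \<gamma> (F (x + h *\<^sub>R u) - F x - D x (h *\<^sub>R u)) =
        f \<gamma> (x + h *\<^sub>R u) - f \<gamma> x - h * \<phi> \<gamma> (D x u)"
      by (simp add: f_def linear_diff[OF lin] linear_scale[OF lin] blinfun.scaleR_right)
    moreover have "\<bar>h * \<phi> \<gamma> (D x u)\<bar> = h * \<bar>\<phi> \<gamma> (D x u)\<bar>"
      using h by (simp add: abs_mult)
    ultimately show ?thesis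
      by (simp add: algebra_simps)
  qed
  have thin: "\<exists>B. full B \<and> B \<subseteq> A \<and>
      (\<forall>\<gamma>\<in>B. \<forall>y\<in>linf_on (B - {\<gamma>}). \<bar>\<phi> \<gamma> (D (p \<gamma>) y)\<bar> \<le> \<epsilon> * norm y)"
    if p: "\<And>\<gamma>. \<gamma> \<in> A \<Longrightarrow> p \<gamma> \<in> ball 0 1" and A: "full A" for p A
  proof -
    \<comment> \<open>The value 0 off \<open>A\<close> makes the family uniformly bounded over all indices.\<close>
    define \<mu> where "\<mu> \<gamma> y = (if \<gamma> \<in> A then \<phi> \<gamma> (D (p \<gamma>) y) else 0)" for \<gamma> y
    have "linear (\<mu> \<gamma>)" for \<gamma>
      by (rule linearI) (simp_all add: \<mu>_def blinfun.add_right blinfun.scaleR_right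
          linear_add[OF lin] linear_scale[OF lin])
    moreover have "\<bar>\<mu> \<gamma> y\<bar> \<le> \<bar>L\<bar> * norm y" for \<gamma> y
    proof (cases "\<gamma> \<in> A")
      case True
      have "\<bar>\<phi> \<gamma> (D (p \<gamma>) y)\<bar> \<le> norm (D (p \<gamma>)) * norm y"
        using \<phi>_le norm_blinfun order_trans by blast
      also have "\<dots> \<le> \<bar>L\<bar> * norm y"
        using L[OF p[OF True]] by (intro mult_right_mono) auto
      finally show ?thesis using True by (simp add: \<mu>_def)
    qed (simp add: \<mu>_def)
    ultimately obtain B where "full B" "B \<subseteq> A"
        "\<And>\<gamma> y. \<gamma> \<in> B \<Longrightarrow> y \<in> linf_on (B - {\<gamma>}) \<Longrightarrow> \<bar>\<mu> \<gamma> y\<bar> \<le> \<epsilon> * norm y"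
      using disjoint_functionals[OF inf _ \<epsilon> _ A, of \<mu> "\<bar>L\<bar>"] by blast
    then show ?thesis
      by (intro exI[of _ B]) (auto simp: \<mu>_def subset_iff)
  qed
  have walk: "\<exists>x A. full A \<and> (\<forall>\<gamma>. 0 \<le> coord x \<gamma> \<and> coord x \<gamma> \<le> real j * h) \<and>
      (\<forall>\<gamma>\<in>A. coord x \<gamma> = real j * h \<and>
        \<bar>f \<gamma> x - f \<gamma> 0\<bar> \<le> real j * h * (\<delta> / 4 + 2 * \<epsilon>) \<and>
        \<bar>f \<gamma> (x + (t - real j * h) *\<^sub>R unit_vec \<gamma>) - f \<gamma> (t *\<^sub>R unit_vec \<gamma>)\<bar> \<le> real j * h * (2 * \<epsilon>))"
    if "j \<le> K" for j
    using that
  proof (induction j)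
    case 0
    show ?case
      by (rule exI[of _ 0], rule exI[of _ UNIV]) (simp add: full_UNIV)
  next
    case (Suc j)
    then obtain x A where A: "full A"
        and x_bd: "\<And>\<gamma>. 0 \<le> coord x \<gamma>" "\<And>\<gamma>. coord x \<gamma> \<le> real j * h"
        and x_eq: "\<And>\<gamma>. \<gamma> \<in> A \<Longrightarrow> coord x \<gamma> = real j * h"
        and low: "\<And>\<gamma>. \<gamma> \<in> A \<Longrightarrow> \<bar>f \<gamma> x - f \<gamma> 0\<bar> \<le> real j * h * (\<delta> / 4 + 2 * \<epsilon>)"
        and high: "\<And>\<gamma>. \<gamma> \<in> A \<Longrightarrow>
          \<bar>f \<gamma> (x + (t - real j * h) *\<^sub>R unit_vec \<gamma>) - f \<gamma> (t *\<^sub>R unit_vec \<gamma>)\<bar> \<le> real j * h * (2 * \<epsilon>)"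
      by auto
    have "real (Suc j) * h \<le> real K * h"
      using Suc.prems h by (intro mult_right_mono) auto
    then have jt: "real (Suc j) * h \<le> t" "real j * h \<le> t"
      using Kh h by (auto simp: algebra_simps)
    have in_ball: "z \<in> ball 0 1" if "\<And>\<gamma>. 0 \<le> coord z \<gamma> \<and> coord z \<gamma> \<le> t" for z :: "'g linf"
    proof -
      have "norm z \<le> t" by (rule norm_linf_le) (use that in auto)
      with t show ?thesis by simp
    qed
    \<comment> \<open>The second walk for \<open>\<gamma>\<close> differs from the first only at the coordinate \<open>\<gamma>\<close>, where it stays at \<open>t\<close>.\<close>
    define p where "p \<gamma> = x + (t - real j * h) *\<^sub>R unit_vec \<gamma>" for \<gamma>
    have x_ball: "x \<in> ball 0 1"
      using x_bd jt by (intro in_ball) (auto intro: order_trans)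
    have p_ball: "p \<gamma> \<in> ball 0 1" if "\<gamma> \<in> A" for \<gamma>
      using x_bd x_eq[OF that] jt
      by (intro in_ball) (auto simp: p_def unit_vec_apply intro: order_trans)
    define A1 where "A1 = A - {\<gamma>. \<delta> / 4 \<le> norm (D x (unit_vec \<gamma>))}"
    have "\<not> full (A \<inter> {\<gamma>. \<delta> / 4 \<le> norm (D x (unit_vec \<gamma>))})"
      using contra x_ball full_mono by (meson Int_lower2)
    then have "full A1"
      unfolding A1_def by (rule full_diff[OF inf A])
    then obtain A2 where A2: "full A2" "A2 \<subseteq> A1"
        and x_small: "\<And>\<gamma> y. \<gamma> \<in> A2 \<Longrightarrow> y \<in> linf_on (A2 - {\<gamma>}) \<Longrightarrow> \<bar>\<phi> \<gamma> (D x y)\<bar> \<le> \<epsilon> * norm y"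
      using thin[of A1 "\<lambda>_. x"] x_ball by blast
    have "A2 \<subseteq> A" using A2 by (auto simp: A1_def)
    then obtain B where B: "full B" "B \<subseteq> A2"
        and p_small: "\<And>\<gamma> y. \<gamma> \<in> B \<Longrightarrow> y \<in> linf_on (B - {\<gamma>}) \<Longrightarrow> \<bar>\<phi> \<gamma> (D (p \<gamma>) y)\<bar> \<le> \<epsilon> * norm y"
      using thin[of A2 p] p_ball A2(1) by blast
    define x' where "x' = x + h *\<^sub>R chi B"
    have BA: "B \<subseteq> A" using B \<open>A2 \<subseteq> A\<close> by blast
    have coord_x': "coord x' \<gamma> = coord x \<gamma> + (if \<gamma> \<in> B then h else 0)" for \<gamma>
      by (simp add: x'_def coord_chi)
    have x'_bd: "0 \<le> coord x' \<gamma>" "coord x' \<gamma> \<le> real (Suc j) * h" for \<gamma>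
      using x_bd[of \<gamma>] h by (auto simp: coord_x' algebra_simps)
    have x'_eq: "coord x' \<gamma> = real (Suc j) * h" if "\<gamma> \<in> B" for \<gamma>
      using that BA x_eq[of \<gamma>] by (auto simp: coord_x' algebra_simps)
    have low': "\<bar>f \<gamma> x' - f \<gamma> 0\<bar> \<le> real (Suc j) * h * (\<delta> / 4 + 2 * \<epsilon>)" if \<gamma>: "\<gamma> \<in> B" for \<gamma>
    proof -
      have "\<phi> \<gamma> (D x (chi B)) = \<phi> \<gamma> (D x (unit_vec \<gamma>)) + \<phi> \<gamma> (D x (chi (B - {\<gamma>})))"
        by (simp add: chi_remove[OF \<gamma>] blinfun.add_right linear_add[OF lin])
      moreover have "\<bar>\<phi> \<gamma> (D x (unit_vec \<gamma>))\<bar> \<le> \<delta> / 4"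
        using \<gamma> B A2 \<phi>_le[of \<gamma> "D x (unit_vec \<gamma>)"] by (auto simp: A1_def subset_iff)
      moreover have "\<bar>\<phi> \<gamma> (D x (chi (B - {\<gamma>})))\<bar> \<le> \<epsilon>"
      proof -
        have "chi (B - {\<gamma>}) \<in> linf_on (A2 - {\<gamma>})"
          using B by (auto simp: linf_on_def coord_chi indicator_def)
        then have "\<bar>\<phi> \<gamma> (D x (chi (B - {\<gamma>})))\<bar> \<le> \<epsilon> * norm (chi (B - {\<gamma>}))"
          using \<gamma> B by (intro x_small) auto
        also have "\<dots> \<le> \<epsilon> * 1"
          using \<epsilon> norm_chi_le by (intro mult_left_mono) auto
        finally show ?thesis by simp
      qed
      ultimately have "\<bar>\<phi> \<gamma> (D x (chi B))\<bar> + \<epsilon> \<le> \<delta> / 4 + 2 * \<epsilon>"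
        by linarith
      then have "h * (\<bar>\<phi> \<gamma> (D x (chi B))\<bar> + \<epsilon>) \<le> h * (\<delta> / 4 + 2 * \<epsilon>)"
        using h by (intro mult_left_mono) auto
      moreover have "x + h *\<^sub>R chi B \<in> ball 0 1"
        using x'_bd jt unfolding x'_def[symmetric] by (intro in_ball) (auto intro: order_trans)
      ultimately have "\<bar>f \<gamma> x' - f \<gamma> x\<bar> \<le> h * (\<delta> / 4 + 2 * \<epsilon>)"
        using increment[OF x_ball _ norm_chi_le, of B \<gamma>] unfolding x'_def by linarith
      moreover have "\<bar>f \<gamma> x - f \<gamma> 0\<bar> \<le> real j * h * (\<delta> / 4 + 2 * \<epsilon>)"
        using low \<gamma> BA by blast
      moreover have "real (Suc j) * h * (\<delta> / 4 + 2 * \<epsilon>) =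
          real j * h * (\<delta> / 4 + 2 * \<epsilon>) + h * (\<delta> / 4 + 2 * \<epsilon>)"
        by (simp add: algebra_simps)
      ultimately show ?thesis by linarith
    qed
    have high': "\<bar>f \<gamma> (x' + (t - real (Suc j) * h) *\<^sub>R unit_vec \<gamma>) - f \<gamma> (t *\<^sub>R unit_vec \<gamma>)\<bar>
        \<le> real (Suc j) * h * (2 * \<epsilon>)" if \<gamma>: "\<gamma> \<in> B" for \<gamma>
    proof -
      let ?q = "x' + (t - real (Suc j) * h) *\<^sub>R unit_vec \<gamma>"
      have q: "?q = p \<gamma> + h *\<^sub>R chi (B - {\<gamma>})"
        by (rule linf_eqI)
          (use \<gamma> in \<open>auto simp: x'_def p_def coord_chi unit_vec_apply indicator_def algebra_simps\<close>)
      have "?q \<in> ball 0 1"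
        using x'_bd x'_eq[OF \<gamma>] jt
        by (intro in_ball) (auto simp: unit_vec_apply intro: order_trans)
      then have "\<bar>f \<gamma> ?q - f \<gamma> (p \<gamma>)\<bar> \<le> h * (\<bar>\<phi> \<gamma> (D (p \<gamma>) (chi (B - {\<gamma>})))\<bar> + \<epsilon>)"
        unfolding q using \<gamma> BA p_ball norm_chi_le by (intro increment) auto
      also have "\<dots> \<le> h * (\<epsilon> * 1 + \<epsilon>)"
      proof -
        have "\<bar>\<phi> \<gamma> (D (p \<gamma>) (chi (B - {\<gamma>})))\<bar> \<le> \<epsilon> * norm (chi (B - {\<gamma>}))"
          using \<gamma> by (intro p_small chi_in_linf_on)
        also have "\<dots> \<le> \<epsilon> * 1"
          using \<epsilon> norm_chi_le by (intro mult_left_mono) auto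
        finally show ?thesis using h by (intro mult_left_mono) auto
      qed
      finally have "\<bar>f \<gamma> ?q - f \<gamma> (p \<gamma>)\<bar> \<le> h * (2 * \<epsilon>)" by simp
      moreover have "\<bar>f \<gamma> (p \<gamma>) - f \<gamma> (t *\<^sub>R unit_vec \<gamma>)\<bar> \<le> real j * h * (2 * \<epsilon>)"
        using high[of \<gamma>] \<gamma> BA by (auto simp: p_def)
      moreover have "real (Suc j) * h * (2 * \<epsilon>) = real j * h * (2 * \<epsilon>) + h * (2 * \<epsilon>)"
        by (simp add: algebra_simps)
      ultimately show ?thesis by linarith
    qed
    show ?case
      using B(1) x'_bd x'_eq low' high' by (intro exI[of _ x'] exI[of _ B]) auto
  qed
  obtain x A where A: "full A"
      and end_low: "\<And>\<gamma>. \<gamma> \<in> A \<Longrightarrow> \<bar>f \<gamma> x - f \<gamma> 0\<bar> \<le> t * (\<delta> / 4 + 2 * \<epsilon>)"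
      and end_high: "\<And>\<gamma>. \<gamma> \<in> A \<Longrightarrow> \<bar>f \<gamma> x - f \<gamma> (t *\<^sub>R unit_vec \<gamma>)\<bar> \<le> t * (2 * \<epsilon>)"
    using walk[OF order_refl] by (auto simp: Kh)
  obtain \<gamma> where \<gamma>: "\<gamma> \<in> A" using full_nonempty[OF A] by blast
  have "\<delta> \<le> f \<gamma> (t *\<^sub>R unit_vec \<gamma>) - f \<gamma> 0"
    using far[of \<gamma>] \<phi>_eq[of \<gamma>] by (simp add: f_def linear_diff[OF lin])
  also have "\<dots> \<le> t * (\<delta> / 4 + 2 * \<epsilon>) + t * (2 * \<epsilon>)"
    using end_low[OF \<gamma>] end_high[OF \<gamma>] by linarith
  also have "\<dots> = t * (3 / 4 * \<delta>)"
    by (simp add: \<epsilon>_def algebra_simps)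
  also have "\<dots> \<le> 1 * (3 / 4 * \<delta>)"
    using t \<delta> by (intro mult_right_mono) auto
  finally show False using \<delta> by simp
qed

section \<open>Smooth maps that separate the unit vectors from zero\<close>

theorem theorem6:
  fixes F :: "'g linf \<Rightarrow> 'x::banach"
  assumes "GCH TYPE('g)" and "GCH TYPE('g linf)" and "GCH TYPE('x)"
    and "infinite (UNIV :: 'g set)" and "regularCard |UNIV :: 'g set|"
    and "F \<in> C1plus (cball 0 1)"
    and "(INF \<gamma>. norm (F (unit_vec \<gamma>) - F 0)) > 0"
  shows "(\<exists>x \<in> cball 0 1. \<exists>G :: 'g set. |G| =o |UNIV :: 'g set| \<and>
            isomorphism_on (linf_on G) (deriv_on (cball 0 1) F x)) \<and>
         (\<exists>(S :: 'x set) (T :: 'g linf \<Rightarrow>\<^sub>L 'x).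
            subspace S \<and> isomorphism_on UNIV T \<and> range (blinfun_apply T) = S)"
proof -
  note inf = \<open>infinite (UNIV :: 'g set)\<close>
  let ?D = "frechet F"
  have interior: "ball 0 1 \<subseteq> interior (cball (0 :: 'g linf) 1)"
    by (rule interior_maximal) (auto simp: ball_subset_cball)
  have cont: "continuous_on (cball 0 1) F"
    and diff: "\<And>x. x \<in> interior (cball 0 1) \<Longrightarrow> F differentiable (at x)"
    and uci: "uniformly_continuous_on (interior (cball 0 1)) ?D"
    using \<open>F \<in> C1plus (cball 0 1)\<close> by (auto simp: C1plus_def)
  have uc: "uniformly_continuous_on (ball 0 1) ?D"
    using uci interior unfolding uniformly_continuous_on_def by (meson subsetD)
  have der: "(F has_derivative blinfun_apply (?D x)) (at x)" if "x \<in> ball 0 1" for x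
    using that interior by (intro frechet_has_derivative diff) auto
  obtain L where L: "L > 0" "\<And>x. x \<in> ball 0 1 \<Longrightarrow> norm (?D x) \<le> L"
    using bounded_if_uniformly_continuous_on_ball[OF uc] by metis
  define \<delta> where "\<delta> = (INF \<gamma>. norm (F (unit_vec \<gamma>) - F 0))"
  have \<delta>: "\<delta> > 0" using assms(7) by (simp add: \<delta>_def)
  have far: "\<delta> \<le> norm (F (unit_vec \<gamma>) - F 0)" for \<gamma>
    unfolding \<delta>_def by (rule cINF_lower) (auto intro!: bdd_belowI2[where m = 0])
  \<comment> \<open>Moving the unit vectors into the open ball by the factor \<open>t\<close> costs at most half of \<open>\<delta>\<close>.\<close>
  define t where "t = 1 - min (1 / 2) (\<delta> / (2 * L))"
  have t: "0 < t" "t < 1" using L(1) \<delta> by (auto simp: t_def min_def)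
  have "L * (1 - t) \<le> L * (\<delta> / (2 * L))"
    using L(1) by (intro mult_left_mono) (auto simp: t_def)
  then have Lt: "L * (1 - t) \<le> \<delta> / 2" using L(1) by simp
  have "\<delta> / 2 \<le> norm (F (t *\<^sub>R unit_vec \<gamma>) - F 0)" for \<gamma>
  proof -
    have "norm (F (unit_vec \<gamma>) - F (t *\<^sub>R unit_vec \<gamma>)) \<le> \<delta> / 2"
      using radial_increment_bound[OF cont der L(2) _ t, of "unit_vec \<gamma>"] Lt
      by (simp add: norm_unit_vec)
    then show ?thesis
      using far[of \<gamma>]
        norm_triangle_ineq[of "F (unit_vec \<gamma>) - F (t *\<^sub>R unit_vec \<gamma>)" "F (t *\<^sub>R unit_vec \<gamma>) - F 0"]
      by simp
  qed
  then obtain x where x: "x \<in> ball 0 1" and large: "full {\<gamma>. \<delta> / 2 / 4 \<le> norm (?D x (unit_vec \<gamma>))}"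
    using large_derivatives_if_separated[OF inf der uc t, of "\<delta> / 2"] \<delta> by auto
  obtain G where G: "full G" and iso: "isomorphism_on (linf_on G) (?D x)"
    using rosenthal_isomorphism[OF inf _ large] \<delta> by auto
  have deriv: "deriv_on (cball 0 1) F x = ?D x"
    using x interior by (auto simp: deriv_on_def)
  \<comment> \<open>The whole space embeds isometrically into the vectors supported in the full set \<open>G\<close>.\<close>
  obtain E :: "'g linf \<Rightarrow>\<^sub>L 'g linf" where E: "\<And>y. norm (E y) = norm y" "\<And>y. E y \<in> linf_on G"
    using linf_embedding[OF G] by metis
  define T where "T = ?D x o\<^sub>L E"
  have "isomorphism_on UNIV T"
    using iso E unfolding isomorphism_on_def T_def by (metis blinfun_apply_blinfun_compose)
  moreover have "subspace (range (blinfun_apply T))"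
    by (rule linear_subspace_image) (simp_all add: blinfun.bounded_linear_right bounded_linear.linear)
  moreover have "x \<in> cball 0 1" "|G| =o |UNIV :: 'g set|"
    using x full_iff_card G by auto
  ultimately show ?thesis
    using iso deriv by metis
qed

end
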